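(* Let $a,b\ge1$ and $n\ge 0$ be integers, and let $e^{a,b}_n$ denote the number of edges of the Horadam cube $\Pi^{a,b}_n$. Then $$e^{a,b}_n=\sum_{k=0}^n(-1)^{n-k}\left\lceil\frac{n+k}{2}\right\rceil\binom{\left\lfloor\frac{n+k}{2}\right\rfloor}{k}a^kb^{\left\lfloor\frac{n-k}{2}\right\rfloor}.$$
   Context: For integers $a,b\ge1$ and $n\ge 0$, $\mathcal S^{a,b}_n$ is the set of all strings of length $n$ over the alphabet $\{0,1,\dots,a+b-1\}$ in which every letter from $\{a,\dots,a+b-1\}$ appears only immediately after a letter $0$; $\mathcal S^{a,b}_0$ contains only the empty string. The Horadam cube $\Pi^{a,b}_n$ is the simple graph with vertex set $\mathcal S^{a,b}_n$ in which $x_1\cdots x_n$ and $y_1\cdots y_n$ are adjacent if and only if $\sum_{i=1}^n|x_i-y_i|=1$. *)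

theory Defs
  imports Complex_Main
begin

definition horadam_strings :: "nat \<Rightarrow> nat \<Rightarrow> nat \<Rightarrow> nat list set" where
  "horadam_strings a b n =
     {w. length w = n \<and> set w \<subseteq> {0..<a + b} \<and>
         (\<forall>i<n. w ! i \<in> {a..<a + b} \<longrightarrow> 0 < i \<and> w ! (i - 1) = 0)}"

(* A finite simple graph is given by its vertex set, here horadam_strings a b n,
   together with a set of unordered pairs (two-element sets) of vertices. The distance is taken
   in int because subtraction on nat truncates. *)

definition horadam_adj :: "nat list \<Rightarrow> nat list \<Rightarrow> bool" where
  "horadam_adj x y \<longleftrightarrow>
     length x = length y \<and> (\<Sum>i<length x. \<bar>int (x ! i) - int (y ! i)\<bar>) = 1"

definition horadam_edges :: "nat \<Rightarrow> nat \<Rightarrow> nat \<Rightarrow> nat list set set" where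
  "horadam_edges a b n =
     {{x, y} | x y. x \<in> horadam_strings a b n \<and> y \<in> horadam_strings a b n \<and> horadam_adj x y}"

end

theory Submission
  imports Defs
begin

text \<open>
  Orient every edge upwards, from a string to the one obtained by raising one letter by 1. Splitting
  strings by their first letter, or by their first two letters when the second one is large, gives
  \<open>s (n + 2) = a * s (n + 1) + b * s n\<close> for the number of vertices and
  \<open>e (n + 2) = a * e (n + 1) + b * e n + s (n + 2) - s (n + 1)\<close> for the number of edges.
  Let \<open>y = a * x + b * x^2\<close>. Then \<open>s\<close> has generating function \<open>1 / (1 - y)\<close>, so \<open>e\<close> has
  \<open>(y - x) / (1 - y)^2\<close>. The terms with \<open>n - k\<close> even come from \<open>y / (1 - y)^2\<close>, those with
  \<open>n - k\<close> odd from \<open>x / (1 - y)^2\<close>.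
\<close>

section \<open>Strings\<close>

text \<open>Call a letter large if it lies in \<open>{a..<a + b}\<close>, otherwise small. These
  lists are the possible tails after an initial 0 that are not Horadam strings themselves, since
  their large first letter has lost its predecessor.\<close>

definition horadam_blocks :: "nat \<Rightarrow> nat \<Rightarrow> nat \<Rightarrow> nat list set" where
  "horadam_blocks a b n = (\<lambda>(y, w). y # w) ` ({a..<a + b} \<times> horadam_strings a b n)"

lemma Cons_in_horadam_blocks [simp]:
  "y # w \<in> horadam_blocks a b n \<longleftrightarrow> y \<in> {a..<a + b} \<and> w \<in> horadam_strings a b n"
  by (auto simp: horadam_blocks_def)

lemma horadam_strings_0 [simp]: "horadam_strings a b 0 = {[]}"
  by (auto simp: horadam_strings_def)

lemma length_horadam_strings: "w \<in> horadam_strings a b n \<Longrightarrow> length w = n"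
  by (simp add: horadam_strings_def)

lemma finite_horadam_strings [simp]: "finite (horadam_strings a b n)"
  by (rule finite_subset[OF _ finite_lists_length_eq[of "{0..<a + b}" n]])
    (auto simp: horadam_strings_def)

lemma Cons_in_horadam_strings_hd:
  "x # w \<in> horadam_strings a b n \<Longrightarrow> x < a"
  by (force simp: horadam_strings_def)

lemma Cons_in_horadam_strings_iff:
  assumes "a \<ge> 1"
  shows "x # w \<in> horadam_strings a b (Suc n) \<longleftrightarrow>
    x < a \<and> length w = n \<and> set w \<subseteq> {0..<a + b} \<and>
    (\<forall>i<n. w ! i \<in> {a..<a + b} \<longrightarrow> (if i = 0 then x = 0 else w ! (i - 1) = 0))"
proof -
  have "(x # w) ! (Suc i - 1) = (if i = 0 then x else w ! (i - 1))" for i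
    by (simp add: nth_Cons')
  then show ?thesis
    by (auto simp: horadam_strings_def All_less_Suc2)
qed

lemma Cons_in_horadam_strings_Suc_0:
  assumes "a \<ge> 1"
  shows "x # w \<in> horadam_strings a b (Suc 0) \<longleftrightarrow> x < a \<and> w = []"
  using assms by (auto simp: Cons_in_horadam_strings_iff)

text \<open>A large second letter forces \<open>x = 0\<close>; being nonzero, it also forbids a
  large third letter, so what follows it is again a Horadam string. If the second letter is small,
  nothing in \<open>w\<close> depends on \<open>x\<close>.\<close>

lemma Cons_in_horadam_strings_Suc_Suc:
  assumes "a \<ge> 1"
  shows "x # w \<in> horadam_strings a b (Suc (Suc n)) \<longleftrightarrow>
    x < a \<and> w \<in> horadam_strings a b (Suc n) \<or> x = 0 \<and> w \<in> horadam_blocks a b n"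
proof (cases w)
  case Nil
  then show ?thesis
    by (auto simp: horadam_blocks_def dest: length_horadam_strings)
next
  case (Cons y v)
  have tail: "v \<in> horadam_strings a b n \<longleftrightarrow> length v = n \<and> set v \<subseteq> {0..<a + b} \<and>
    (\<forall>i<n. v ! i \<in> {a..<a + b} \<longrightarrow> 0 < i \<and> v ! (i - 1) = 0)"
    by (simp add: horadam_strings_def)
  have "x # y # v \<in> horadam_strings a b (Suc (Suc n)) \<longleftrightarrow>
    x < a \<and> length v = n \<and> y < a + b \<and> set v \<subseteq> {0..<a + b} \<and> (a \<le> y \<longrightarrow> x = 0) \<and>
    (\<forall>i<n. v ! i \<in> {a..<a + b} \<longrightarrow> (if i = 0 then y else v ! (i - 1)) = 0)"
    unfolding Cons_in_horadam_strings_iff[OF assms] All_less_Suc2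
    by (auto simp: nth_Cons')
  also have "\<dots> \<longleftrightarrow> x < a \<and> y # v \<in> horadam_strings a b (Suc n) \<or>
      x = 0 \<and> y \<in> {a..<a + b} \<and> v \<in> horadam_strings a b n"
  proof (cases "y < a")
    case True
    then show ?thesis
      unfolding Cons_in_horadam_strings_iff[OF assms] by (auto split: if_splits)
  next
    case False
    then show ?thesis
      unfolding Cons_in_horadam_strings_iff[OF assms] tail using assms
      by (auto split: if_splits intro!: gr0I)
  qed
  finally show ?thesis
    using Cons by (auto simp: horadam_blocks_def)
qed

lemma Cons_in_horadam_strings:
  assumes "a \<ge> 1" "x < a" "w \<in> horadam_strings a b n"
  shows "x # w \<in> horadam_strings a b (Suc n)"
  using assms by (cases n) (auto simp: Cons_in_horadam_strings_Suc_0 Cons_in_horadam_strings_Suc_Suc)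

lemma horadam_strings_Suc_Suc:
  assumes "a \<ge> 1"
  shows "horadam_strings a b (Suc (Suc n)) =
    (\<lambda>(x, w). x # w) ` ({..<a} \<times> horadam_strings a b (Suc n)) \<union> Cons 0 ` horadam_blocks a b n"
  (is "?L = ?R")
proof (rule set_eqI)
  fix w
  show "w \<in> ?L \<longleftrightarrow> w \<in> ?R"
  proof (cases w)
    case Nil
    then show ?thesis by (auto dest: length_horadam_strings)
  next
    case (Cons x v)
    then show ?thesis
      by (auto simp: Cons_in_horadam_strings_Suc_Suc[OF assms])
  qed
qed

lemma horadam_blocks_disjoint: "horadam_strings a b m \<inter> horadam_blocks a b n = {}"
  by (auto simp: horadam_blocks_def dest: Cons_in_horadam_strings_hd)

lemma card_horadam_blocks: "card (horadam_blocks a b n) = b * card (horadam_strings a b n)"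
  unfolding horadam_blocks_def by (subst card_image) (auto simp: inj_on_def card_cartesian_product)

lemma finite_horadam_blocks [simp]: "finite (horadam_blocks a b n)"
  by (simp add: horadam_blocks_def)

lemma card_horadam_strings_Suc_0:
  assumes "a \<ge> 1"
  shows "card (horadam_strings a b (Suc 0)) = a"
proof -
  have "horadam_strings a b (Suc 0) = (\<lambda>x. [x]) ` {..<a}"
  proof (rule set_eqI)
    fix w
    show "w \<in> horadam_strings a b (Suc 0) \<longleftrightarrow> w \<in> (\<lambda>x. [x]) ` {..<a}"
      by (cases w) (auto simp: Cons_in_horadam_strings_Suc_0[OF assms] dest: length_horadam_strings)
  qed
  then show ?thesis
    by (simp add: card_image inj_on_def)
qed

lemma card_horadam_strings_Suc_Suc:
  assumes "a \<ge> 1"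
  shows "card (horadam_strings a b (Suc (Suc n))) =
    a * card (horadam_strings a b (Suc n)) + b * card (horadam_strings a b n)"
proof -
  have "card ((\<lambda>(x, w). x # w) ` ({..<a} \<times> horadam_strings a b (Suc n))) =
      a * card (horadam_strings a b (Suc n))"
    by (subst card_image) (auto simp: inj_on_def card_cartesian_product)
  moreover have "card (Cons 0 ` horadam_blocks a b n) = b * card (horadam_strings a b n)"
    by (simp add: card_image card_horadam_blocks)
  ultimately show ?thesis
    unfolding horadam_strings_Suc_Suc[OF assms] using horadam_blocks_disjoint[of a b "Suc n" n]
    by (subst card_Un_disjoint) auto
qed

section \<open>Edges\<close>

text \<open>The oriented form of adjacency, recursive so that it follows the splitting of strings at
  their first letters.\<close>

fun step_up :: "nat list \<Rightarrow> nat list \<Rightarrow> bool" where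
  "step_up (u # x) (v # y) \<longleftrightarrow> v = Suc u \<and> x = y \<or> u = v \<and> step_up x y"
| "step_up _ _ \<longleftrightarrow> False"

lemma sum_list_step_up: "step_up x y \<Longrightarrow> sum_list y = Suc (sum_list x)"
  by (induction x y rule: step_up.induct) auto

lemma step_up_length: "step_up x y \<Longrightarrow> length x = length y"
  by (induction x y rule: step_up.induct) auto

lemma sum_abs_diff_eq_0_iff:
  "length x = length y \<Longrightarrow> (\<Sum>i<length x. \<bar>int (x ! i) - int (y ! i)\<bar>) = 0 \<longleftrightarrow> x = y"
  by (subst sum_nonneg_eq_0_iff) (auto simp: list_eq_iff_nth_eq)

lemma sum_abs_diff_eq_1_iff:
  "length x = length y \<Longrightarrow>
    (\<Sum>i<length x. \<bar>int (x ! i) - int (y ! i)\<bar>) = 1 \<longleftrightarrow> step_up x y \<or> step_up y x"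
proof (induction x y rule: list_induct2)
  case Nil
  then show ?case by simp
next
  case (Cons u x v y)
  let ?d = "\<Sum>i<length x. \<bar>int (x ! i) - int (y ! i)\<bar>"
  \<comment> \<open>Nonnegative integers add up to 1 only as 0 + 1 or 1 + 0: either the heads agree
    or the tails do.\<close>
  have "0 \<le> ?d"
    by (simp add: sum_nonneg)
  then have "\<bar>int u - int v\<bar> + ?d = 1 \<longleftrightarrow>
      u = v \<and> ?d = 1 \<or> (u = Suc v \<or> v = Suc u) \<and> ?d = 0"
    by presburger
  moreover have "?d = 0 \<longleftrightarrow> x = y"
    using Cons.hyps by (rule sum_abs_diff_eq_0_iff)
  ultimately show ?case
    using Cons.IH by (auto simp: sum.lessThan_Suc_shift simp del: sum.lessThan_Suc)
qed

lemma horadam_adj_iff: "horadam_adj x y \<longleftrightarrow> step_up x y \<or> step_up y x"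
  using sum_abs_diff_eq_1_iff[of x y] step_up_length[of x y] step_up_length[of y x]
  by (auto simp: horadam_adj_def)

definition up_edges :: "nat \<Rightarrow> nat \<Rightarrow> nat \<Rightarrow> (nat list \<times> nat list) set" where
  "up_edges a b n =
    {(x, y). x \<in> horadam_strings a b n \<and> y \<in> horadam_strings a b n \<and> step_up x y}"

lemma finite_up_edges [simp]: "finite (up_edges a b n)"
  by (rule finite_subset[of _ "horadam_strings a b n \<times> horadam_strings a b n"])
    (auto simp: up_edges_def)

text \<open>Raising a letter raises the letter sum, so the two ends of an edge can be ordered in
  only one way.\<close>

lemma card_horadam_edges: "card (horadam_edges a b n) = card (up_edges a b n)"
proof -
  have "horadam_edges a b n = (\<lambda>(x, y). {x, y}) ` up_edges a b n"
    unfolding horadam_edges_def up_edges_def horadam_adj_iff by (auto simp: image_iff)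
  moreover have "inj_on (\<lambda>(x, y). {x, y}) (up_edges a b n)"
    by (auto simp: inj_on_def up_edges_def doubleton_eq_iff dest!: sum_list_step_up)
  ultimately show ?thesis
    by (simp add: card_image)
qed

lemma up_edges_0 [simp]: "up_edges a b 0 = {}"
  by (auto simp: up_edges_def)

lemma card_up_edges_Suc_0:
  assumes "a \<ge> 1"
  shows "card (up_edges a b (Suc 0)) = a - 1"
proof -
  have "up_edges a b (Suc 0) = (\<lambda>x. ([x], [Suc x])) ` {..<a - 1}"
  proof (rule set_eqI)
    fix p :: "nat list \<times> nat list"
    obtain x y where p: "p = (x, y)" by (cases p)
    show "p \<in> up_edges a b (Suc 0) \<longleftrightarrow> p \<in> (\<lambda>x. ([x], [Suc x])) ` {..<a - 1}"
      unfolding p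
      by (cases x; cases y)
        (auto simp: up_edges_def Cons_in_horadam_strings_Suc_0[OF assms]
          dest: length_horadam_strings)
  qed
  then show ?thesis
    by (simp add: card_image inj_on_def)
qed

text \<open>Edges are sorted by the place of the raised letter. In \<open>?A\<close> it is the first
  one; the upper end then starts with a nonzero letter, so the common tail is a Horadam string.
  \<open>?B\<close> moves between Horadam tails, \<open>?C\<close> moves behind 0 and a fixed large
  letter, and \<open>?D\<close> raises the second letter to a large one. The range in
  \<open>?D\<close> starts at \<open>a - 1\<close> to include the step from the last small letter to
  the first large one.\<close>

lemma up_edges_Suc_Suc:
  assumes "a \<ge> 1"
  shows "up_edges a b (Suc (Suc n)) =
    (\<lambda>(x, w). (x # w, Suc x # w)) ` ({..<a - 1} \<times> horadam_strings a b (Suc n)) \<union>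
    ((\<lambda>(x, w, w'). (x # w, x # w')) ` ({..<a} \<times> up_edges a b (Suc n)) \<union>
    ((\<lambda>(y, w, w'). (0 # y # w, 0 # y # w')) ` ({a..<a + b} \<times> up_edges a b n) \<union>
     (\<lambda>(y, w). (0 # y # w, 0 # Suc y # w)) ` ({a - 1..<a + b - 1} \<times> horadam_strings a b n)))"
  (is "?L = ?A \<union> (?B \<union> (?C \<union> ?D))")
proof (rule set_eqI)
  fix p :: "nat list \<times> nat list"
  obtain x y where p: "p = (x, y)" by (cases p)
  let ?S = "horadam_strings a b" and ?T = "horadam_blocks a b"
  note mem = Cons_in_horadam_strings_Suc_Suc[OF assms]
  note small = Cons_in_horadam_strings[OF assms]
  show "p \<in> ?L \<longleftrightarrow> p \<in> ?A \<union> (?B \<union> (?C \<union> ?D))"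
  proof
    assume "p \<in> ?L"
    then have x: "x \<in> ?S (Suc (Suc n))" and y: "y \<in> ?S (Suc (Suc n))" and up: "step_up x y"
      by (auto simp: p up_edges_def)
    obtain u x' v y' where xy: "x = u # x'" "y = v # y'"
      using up by (cases x; cases y) auto
    consider (head) "v = Suc u" "x' = y'" | (tail) "u = v" "step_up x' y'"
      using up xy by auto
    then show "p \<in> ?A \<union> (?B \<union> (?C \<union> ?D))"
    proof cases
      case head
      then have "p \<in> ?A"
        using y by (auto simp: p xy mem)
      then show ?thesis ..
    next
      case tail
      \<comment> \<open>\<open>S\<close> and \<open>T\<close> record whether the second letter is
        small or large, first for the lower end and then for the upper end.\<close>
      consider (SS) "u < a" "x' \<in> ?S (Suc n)" "y' \<in> ?S (Suc n)"
        | (ST) "u = 0" "x' \<in> ?S (Suc n)" "y' \<in> ?T n"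
        | (TS) "u = 0" "x' \<in> ?T n" "y' \<in> ?S (Suc n)"
        | (TT) "u = 0" "x' \<in> ?T n" "y' \<in> ?T n"
        using x y tail(1) by (auto simp: xy mem)
      then show ?thesis
      proof cases
        case SS
        then have "p \<in> ?B"
          using tail by (auto simp: p xy up_edges_def intro!: image_eqI[where x = "(u, x', y')"])
        then show ?thesis by blast
      next
        \<comment> \<open>The only step from a small to a large letter is from \<open>a - 1\<close>
          to \<open>a\<close>.\<close>
        case ST
        then obtain d w c w' where cd: "y' = d # w" "a \<le> d" "d < a + b" "w \<in> ?S n" "x' = c # w'"
          using tail(2) by (cases x') (auto simp: horadam_blocks_def)
        with ST have "c < a"
          by (auto dest: Cons_in_horadam_strings_hd)
        with cd tail(2) have "d = Suc c" "w' = w"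
          by auto
        with cd ST tail have "p \<in> ?D"
          by (auto simp: p xy intro!: image_eqI[where x = "(c, w)"])
        then show ?thesis by blast
      next
        \<comment> \<open>Here the second letter would have to fall from large to small.\<close>
        case TS
        then show ?thesis
          using tail(2) by (cases y') (auto simp: horadam_blocks_def dest: Cons_in_horadam_strings_hd)
      next
        case TT
        then obtain c w d w' where cd: "x' = c # w" "y' = d # w'" "a \<le> c" "c < a + b" "d < a + b"
          "w \<in> ?S n" "w' \<in> ?S n"
          by (auto simp: horadam_blocks_def)
        with tail(2) consider "d = Suc c" "w = w'" | "c = d" "step_up w w'"
          by auto
        then have "p \<in> ?C \<union> ?D"
        proof cases
          case 1
          with cd TT tail have "p \<in> ?D"
            by (auto simp: p xy intro!: image_eqI[where x = "(c, w)"])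
          then show ?thesis ..
        next
          case 2
          with cd TT tail have "p \<in> ?C"
            by (auto simp: p xy up_edges_def intro!: image_eqI[where x = "(c, w, w')"])
          then show ?thesis ..
        qed
        then show ?thesis by blast
      qed
    qed
  next
    assume "p \<in> ?A \<union> (?B \<union> (?C \<union> ?D))"
    then consider "p \<in> ?A" | "p \<in> ?B" | "p \<in> ?C" | "p \<in> ?D"
      by blast
    then show "p \<in> ?L"
    proof cases
      case 4
      then obtain c w where cw: "p = (0 # c # w, 0 # Suc c # w)" "w \<in> ?S n"
        "a - 1 \<le> c" "c < a + b - 1"
        by auto
      \<comment> \<open>Stated for an arbitrary second letter so that it serves both ends of the
        edge, \<open>c\<close> and \<open>Suc c\<close>.\<close>
      have "0 # c # w \<in> ?S (Suc (Suc n))" if "c < a + b" for c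
        using that cw(2) assms by (cases "c < a") (auto simp: mem horadam_blocks_def small)
      then show ?thesis
        using cw by (auto simp: up_edges_def)
    qed (auto simp: up_edges_def mem)
  qed
qed

lemma card_up_edges_Suc_Suc:
  assumes "a \<ge> 1"
  shows "card (up_edges a b (Suc (Suc n))) =
    (a - 1) * card (horadam_strings a b (Suc n)) + (a * card (up_edges a b (Suc n)) +
    (b * card (up_edges a b n) + b * card (horadam_strings a b n)))"
proof -
  let ?A = "(\<lambda>(x, w). (x # w, Suc x # w)) ` ({..<a - 1} \<times> horadam_strings a b (Suc n))"
  let ?B = "(\<lambda>(x, w, w'). (x # w, x # w')) ` ({..<a} \<times> up_edges a b (Suc n))"
  let ?C = "(\<lambda>(y, w, w'). (0 # y # w, 0 # y # w')) ` ({a..<a + b} \<times> up_edges a b n)"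
  let ?D = "(\<lambda>(y, w). (0 # y # w, 0 # Suc y # w)) `
    ({a - 1..<a + b - 1} \<times> horadam_strings a b n)"
  have "card ?A = (a - 1) * card (horadam_strings a b (Suc n))"
    by (subst card_image) (auto simp: inj_on_def card_cartesian_product)
  moreover have "card ?B = a * card (up_edges a b (Suc n))"
    by (subst card_image) (auto simp: inj_on_def card_cartesian_product)
  moreover have "card ?C = b * card (up_edges a b n)"
    by (subst card_image) (auto simp: inj_on_def card_cartesian_product)
  moreover have "card ?D = b * card (horadam_strings a b n)"
    using assms by (subst card_image) (auto simp: inj_on_def card_cartesian_product)
  \<comment> \<open>Only \<open>?A\<close> changes the first letter. The upper end has a small
    second letter in \<open>?B\<close> and a large one in \<open>?C\<close> and \<open>?D\<close>;
    of these two, only \<open>?D\<close> changes it.\<close>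
  moreover have "?A \<inter> (?B \<union> (?C \<union> ?D)) = {}"
    by auto
  moreover have "?B \<inter> (?C \<union> ?D) = {}"
    by (auto simp: up_edges_def dest!: Cons_in_horadam_strings_hd)
  moreover have "?C \<inter> ?D = {}"
    by auto
  ultimately show ?thesis
    unfolding up_edges_Suc_Suc[OF assms]
    by (simp only: card_Un_disjoint finite_Un finite_imageI finite_cartesian_product
      finite_horadam_strings finite_up_edges finite_lessThan finite_atLeastLessThan simp_thms)
qed

section \<open>Diagonal sums\<close>

text \<open>With \<open>y = a * x + b * x^2\<close>, this is the coefficient of \<open>x^n\<close>
  in the sum of \<open>c m * y^m\<close> over all \<open>m\<close>: of the \<open>m = n - j\<close>
  factors, \<open>j\<close> contribute \<open>b * x^2\<close>. The weights \<open>1\<close>,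
  \<open>m\<close> and \<open>m + 1\<close> belong to \<open>1 / (1 - y)\<close>,
  \<open>y / (1 - y)^2\<close> and \<open>1 / (1 - y)^2\<close>.\<close>

definition diag_sum :: "(nat \<Rightarrow> int) \<Rightarrow> int \<Rightarrow> int \<Rightarrow> nat \<Rightarrow> int" where
  "diag_sum c a b n =
    (\<Sum>j\<le>n. c (n - j) * int ((n - j) choose j) * a ^ (n - 2 * j) * b ^ j)"

lemma diag_sum_0 [simp]: "diag_sum c a b 0 = c 0"
  by (simp add: diag_sum_def)

lemma diag_sum_Suc_0 [simp]: "diag_sum c a b (Suc 0) = c 1 * a"
  by (simp add: diag_sum_def)

text \<open>For \<open>2 * j > n\<close> the binomial coefficient vanishes, so the truncated
  exponent \<open>n - 2 * j\<close> does no harm.\<close>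

lemma diag_sum_half:
  "diag_sum c a b n =
    (\<Sum>j\<le>n div 2. c (n - j) * int ((n - j) choose j) * a ^ (n - 2 * j) * b ^ j)"
  unfolding diag_sum_def by (rule sum.mono_neutral_right) auto

text \<open>Splitting one factor \<open>y\<close> off each power \<open>y^m\<close> shifts the
  weights by one; on coefficients this is Pascal's rule.\<close>

lemma diag_sum_Suc_Suc:
  "diag_sum c a b (Suc (Suc n)) =
    a * diag_sum (\<lambda>m. c (Suc m)) a b (Suc n) + b * diag_sum (\<lambda>m. c (Suc m)) a b n"
proof -
  let ?t = "\<lambda>j. c (Suc (Suc n) - j) * a ^ (Suc (Suc n) - 2 * j) * b ^ j"
  let ?p = "\<lambda>j. ?t j * int ((Suc n - j) choose j)"
  let ?q = "\<lambda>j. ?t (Suc j) * int ((n - j) choose j)"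
  have p: "?p j = a * (c (Suc (Suc n - j)) * int ((Suc n - j) choose j) * a ^ (Suc n - 2 * j) * b ^ j)"
    if "j \<le> Suc n" for j
  proof (cases "2 * j \<le> Suc n")
    case True
    then have "Suc (Suc n) - 2 * j = Suc (Suc n - 2 * j)" "Suc (Suc n) - j = Suc (Suc n - j)"
      by auto
    then show ?thesis by simp
  next
    case False
    then have "Suc n - j < j"
      using that by auto
    then show ?thesis by simp
  qed
  have q: "?q j = b * (c (Suc (n - j)) * int ((n - j) choose j) * a ^ (n - 2 * j) * b ^ j)"
    if "j \<le> n" for j
    using that by (simp add: Suc_diff_le)
  have pascal: "?t (Suc j) * int ((Suc n - j) choose Suc j) = ?p (Suc j) + ?q j" if "j \<le> n" for j
    using that by (simp add: Suc_diff_le algebra_simps)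
  \<comment> \<open>The last term, at \<open>j = n + 2\<close>, contains
    \<open>0 choose (n + 2)\<close> and drops out.\<close>
  have "diag_sum c a b (Suc (Suc n)) =
      (\<Sum>j\<le>Suc n. ?t j * int ((Suc (Suc n) - j) choose j))"
    unfolding diag_sum_def by (subst sum.atMost_Suc) (simp add: mult_ac)
  also have "\<dots> = ?t 0 + (\<Sum>j\<le>n. ?t (Suc j) * int ((Suc n - j) choose Suc j))"
    by (subst sum.atMost_Suc_shift) simp
  also have "(\<Sum>j\<le>n. ?t (Suc j) * int ((Suc n - j) choose Suc j)) = (\<Sum>j\<le>n. ?p (Suc j) + ?q j)"
    by (intro sum.cong refl pascal) simp
  also have "?t 0 + \<dots> = (\<Sum>j\<le>Suc n. ?p j) + (\<Sum>j\<le>n. ?q j)"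
    unfolding sum.atMost_Suc_shift[of ?p] sum.distrib by simp
  also have "(\<Sum>j\<le>Suc n. ?p j) = a * diag_sum (\<lambda>m. c (Suc m)) a b (Suc n)"
    unfolding diag_sum_def sum_distrib_left by (intro sum.cong refl p) simp
  also have "(\<Sum>j\<le>n. ?q j) = b * diag_sum (\<lambda>m. c (Suc m)) a b n"
    unfolding diag_sum_def sum_distrib_left by (intro sum.cong refl q) simp
  finally show ?thesis .
qed

lemma diag_sum_add: "diag_sum (\<lambda>m. c m + d m) a b n = diag_sum c a b n + diag_sum d a b n"
  by (simp add: diag_sum_def algebra_simps sum.distrib)

text \<open>Constant weights are unchanged by the shift, so both sides obey the same recursion with
  starting values 1 and \<open>a\<close>.\<close>

lemma card_horadam_strings_eq_diag_sum:
  assumes "a \<ge> 1"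
  shows "int (card (horadam_strings a b n)) = diag_sum (\<lambda>_. 1) (int a) (int b) n"
  by (induction n rule: induct_nat_012)
    (simp_all add: card_horadam_strings_Suc_0[OF assms] card_horadam_strings_Suc_Suc[OF assms]
      diag_sum_Suc_Suc)

text \<open>This is the coefficient form of \<open>(y - x) / (1 - y)^2\<close>; the factor
  \<open>x\<close> lowers the index of the second sum to \<open>n\<close>.\<close>

lemma card_up_edges_Suc_eq_diag_sum:
  assumes "a \<ge> 1"
  shows "int (card (up_edges a b (Suc n))) =
    diag_sum int (int a) (int b) (Suc n) - diag_sum (\<lambda>m. 1 + int m) (int a) (int b) n"
proof (induction n rule: induct_nat_012)
  case 0
  show ?case
    using assms by (simp add: card_up_edges_Suc_0)
next
  case 1
  show ?case
    using assms
    by (cases a) (simp_all add: card_up_edges_Suc_Suc card_up_edges_Suc_0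
      card_horadam_strings_Suc_0 diag_sum_Suc_Suc algebra_simps)
next
  case (ge2 n)
  have "int (card (up_edges a b (Suc (Suc (Suc n))))) =
      (int a - 1) * diag_sum (\<lambda>_. 1) (int a) (int b) (Suc (Suc n)) +
      int a * int (card (up_edges a b (Suc (Suc n)))) + int b * int (card (up_edges a b (Suc n))) +
      int b * diag_sum (\<lambda>_. 1) (int a) (int b) (Suc n)"
    using assms
    by (simp add: card_up_edges_Suc_Suc of_nat_diff flip: card_horadam_strings_eq_diag_sum[OF assms])
  then show ?case
    \<comment> \<open>The shift turns each weight into itself plus 1. Splitting off the constant
      weights leaves a linear identity between diagonal sums.\<close>
    unfolding ge2
    by (simp add: diag_sum_Suc_Suc[of int] diag_sum_Suc_Suc[of "\<lambda>m. 1 + int m"]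
      diag_sum_Suc_Suc[of "\<lambda>_. 1"] diag_sum_add algebra_simps)
qed

section \<open>The closed formula\<close>

lemma sum_parity_split:
  fixes f :: "nat \<Rightarrow> 'a::comm_monoid_add"
  shows "sum f {..Suc n} = (\<Sum>j\<le>Suc n div 2. f (2 * j)) + (\<Sum>j\<le>n div 2. f (Suc (2 * j)))"
proof -
  have "{..Suc n} = (\<lambda>j. 2 * j) ` {..Suc n div 2} \<union> (\<lambda>j. Suc (2 * j)) ` {..n div 2}"
  proof (rule set_eqI)
    fix i
    show "i \<in> {..Suc n} \<longleftrightarrow>
      i \<in> (\<lambda>j. 2 * j) ` {..Suc n div 2} \<union> (\<lambda>j. Suc (2 * j)) ` {..n div 2}"
      by (cases "even i") (auto elim!: evenE oddE)
  qed
  moreover have "(\<lambda>j. 2 * j) ` {..Suc n div 2} \<inter> (\<lambda>j. Suc (2 * j)) ` {..n div 2} = {}"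
    by auto presburger
  ultimately show ?thesis
    by (simp add: sum.union_disjoint sum.reindex inj_on_def)
qed

lemma ceiling_half_nat: "\<lceil>real m / 2\<rceil> = int (Suc m div 2)"
  by (rule ceiling_unique) (auto simp: field_simps)

lemma floor_half_nat: "\<lfloor>real m / 2\<rfloor> = int (m div 2)"
  using floor_divide_of_nat_eq[of m 2, where 'a = real] by simp

theorem theorem5:
  fixes a b n :: nat
  assumes "a \<ge> 1" and "b \<ge> 1"
  shows "int (card (horadam_edges a b n)) =
    (\<Sum>k=0..n. (-1) ^ (n - k) * \<lceil>real (n + k) / 2\<rceil>
        * int (nat \<lfloor>real (n + k) / 2\<rfloor> choose k)
        * int a ^ k * int b ^ nat \<lfloor>real (n - k) / 2\<rfloor>)"
proof (cases n)
  case 0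
  then show ?thesis
    by (simp add: card_horadam_edges)
next
  case (Suc m)
  \<comment> \<open>\<open>f i\<close> is the summand for \<open>k = n - i\<close>, where
    \<open>n + k = 2 * n - i\<close>; the ceiling of half of it is
    \<open>Suc (2 * n - i) div 2\<close>.\<close>
  define f where "f i = (-1) ^ i * int (Suc (2 * n - i) div 2) * int ((2 * n - i) div 2 choose (n - i))
    * int a ^ (n - i) * int b ^ (i div 2)" for i
  have "(\<Sum>k=0..n. (-1) ^ (n - k) * \<lceil>real (n + k) / 2\<rceil>
        * int (nat \<lfloor>real (n + k) / 2\<rfloor> choose k)
        * int a ^ k * int b ^ nat \<lfloor>real (n - k) / 2\<rfloor>) = (\<Sum>k\<le>n. f (n - k))"
    unfolding atMost_atLeast0 ceiling_half_nat floor_half_nat nat_int f_def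
    by (intro sum.cong refl) (simp add: mult_2)
  also have "\<dots> = sum f {..n}"
    by (rule sum.nat_diff_reindex[of f "Suc n", unfolded lessThan_Suc_atMost, simplified])
  also have "\<dots> = (\<Sum>j\<le>n div 2. f (2 * j)) + (\<Sum>j\<le>m div 2. f (Suc (2 * j)))"
    unfolding Suc by (rule sum_parity_split)
  \<comment> \<open>For \<open>i = 2 * j\<close>, floor and ceiling both equal \<open>n - j\<close>,
    which becomes the weight; symmetry of the binomial coefficient does the rest.\<close>
  also have "(\<Sum>j\<le>n div 2. f (2 * j)) = diag_sum int (int a) (int b) n"
    unfolding diag_sum_half
  proof (intro sum.cong refl)
    fix j assume "j \<in> {..n div 2}"
    then have "2 * j \<le> n" by auto
    moreover from this have "(n - j) choose (n - 2 * j) = (n - j) choose j"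
      by (subst binomial_symmetric) auto
    moreover have "Suc (2 * n - 2 * j) div 2 = n - j" "(2 * n - 2 * j) div 2 = n - j"
      by (auto simp flip: right_diff_distrib')
    ultimately show "f (2 * j) =
        int (n - j) * int (n - j choose j) * int a ^ (n - 2 * j) * int b ^ j"
      unfolding f_def by (simp add: algebra_simps)
  qed
  \<comment> \<open>For \<open>i = 2 * j + 1\<close> and \<open>n = m + 1\<close>, the floor is
    \<open>m - j\<close> but the ceiling is one more, hence the weight with the extra 1; the sign is
    negative.\<close>
  also have "(\<Sum>j\<le>m div 2. f (Suc (2 * j))) = - diag_sum (\<lambda>m. 1 + int m) (int a) (int b) m"
    unfolding diag_sum_half sum_negf[symmetric]
  proof (intro sum.cong refl)
    fix j assume "j \<in> {..m div 2}"
    then have j: "2 * j \<le> m" by auto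
    then have "(m - j) choose (m - 2 * j) = (m - j) choose j"
      by (subst binomial_symmetric) auto
    moreover have "Suc (2 * n - Suc (2 * j)) div 2 = Suc (m - j)"
      "(2 * n - Suc (2 * j)) div 2 = m - j" "n - Suc (2 * j) = m - 2 * j"
      using Suc j by auto
    ultimately show "f (Suc (2 * j)) =
        - ((1 + int (m - j)) * int (m - j choose j) * int a ^ (m - 2 * j) * int b ^ j)"
      unfolding f_def by (simp add: algebra_simps)
  qed
  finally show ?thesis
    using card_up_edges_Suc_eq_diag_sum[OF assms(1), of b m] Suc by (simp add: card_horadam_edges)
qed

end
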